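(* Let $n\ge 2$, $sl_n=sl_n(\mathbf{C})$, and let $B:(sl_n)^*\to sl_n$ be the linear isomorphism determined by $f_{i,j}\mapsto E_{j,i}$. Then the bilinear form $(\cdot,\cdot)_B: sl_n\times sl_n\to\mathbf{C}$ defined by $$(x,y)_B=B^{-1}(x)(y)$$ is a non-zero scalar multiple of the Killing form of $sl_n$.
   Context: $E_{i,j}$ denotes the matrix units in $gl_n=gl_n(\mathbf{C})$, and $\{f_{i,j}\}_{1\le i,j\le n}$ is the basis of $(gl_n)^*$ with $f_{i,j}(E_{k,l})=\delta_{i,k}\delta_{j,l}$ (Kronecker deltas). The space $(sl_n)^*$ is regarded as a subspace of $(gl_n)^*$ by extending each functional on $sl_n$ to $gl_n=sl_n\oplus\mathbf{C}I$ by zero on the identity matrix $I$, and $B$ is the restriction to $(sl_n)^*$ of the linear map $(gl_n)^*\to gl_n$, $f_{i,j}\mapsto E_{j,i}$; it maps $(sl_n)^*$ bijectively onto $sl_n$. *)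

theory Defs
  imports "HOL-Analysis.Analysis"
begin

section \<open>Linear functionals, traces and Killing forms on subspaces\<close>

context vector_space
begin

text \<open>
  The dual of a subspace \<open>V\<close>. Functionals are extensional (\<open>undefined\<close> outside \<open>V\<close>), so that equality
  of functions is equality of functionals on \<open>V\<close>; for \<open>V = UNIV\<close> this is no restriction.
\<close>

definition dual_on :: "'b set \<Rightarrow> ('b \<Rightarrow> 'a) set" where
  "dual_on V = {\<phi> \<in> extensional V.
     (\<forall>x\<in>V. \<forall>y\<in>V. \<phi> (x + y) = \<phi> x + \<phi> y) \<and> (\<forall>c. \<forall>x\<in>V. \<phi> (scale c x) = c * \<phi> x)}"

text \<open>
  The trace of an endomorphism \<open>T\<close> of the finite-dimensional subspace \<open>V\<close>, computed in an arbitrary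
  basis \<open>S\<close>; \<open>trace_on_eq\<close> below shows independence of the choice.
\<close>

definition trace_on :: "'b set \<Rightarrow> ('b \<Rightarrow> 'b) \<Rightarrow> 'a" where
  "trace_on V T =
     (let S = (SOME S. independent S \<and> span S = V) in \<Sum>b\<in>S. representation S (T b) b)"

text \<open>The Killing form of the Lie algebra with underlying space \<open>V\<close> and bracket \<open>br\<close>; \<open>ad x = br x\<close>.\<close>

definition killing_form :: "'b set \<Rightarrow> ('b \<Rightarrow> 'b \<Rightarrow> 'b) \<Rightarrow> 'b \<Rightarrow> 'b \<Rightarrow> 'a" where
  "killing_form V br x y = local.trace_on V (br x \<circ> br y)"

lemma trace_on_eq:
  assumes S: "independent S" "span S = V" "finite S"
    and T: "\<And>x. x \<in> V \<Longrightarrow> T x \<in> V"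
    and add: "\<And>x y. x \<in> V \<Longrightarrow> y \<in> V \<Longrightarrow> T (x + y) = T x + T y"
    and scl: "\<And>c x. x \<in> V \<Longrightarrow> T (scale c x) = scale c (T x)"
  shows "local.trace_on V T = (\<Sum>b\<in>S. representation S (T b) b)"
proof -
  define R where "R = (SOME S. independent S \<and> span S = V)"
  have R: "independent R" "span R = V"
    using someI[of "\<lambda>S. independent S \<and> span S = V" S] S unfolding R_def by auto
  have "finite R"
    using independent_span_bound[OF S(3) R(1)] R(2) S(2) span_superset by blast
  have SV: "S \<subseteq> V" and RV: "R \<subseteq> V" using S(2) R(2) span_superset by auto
  have subV: "subspace V" using S(2) subspace_span by metis
  have Tsum: "T (\<Sum>a\<in>A. scale (g a) a) = (\<Sum>a\<in>A. scale (g a) (T a))" if "finite A" "A \<subseteq> V" for A g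
    using that
  proof (induction A)
    case empty
    have "0 \<in> V" using subV subspace_0 by blast
    from scl[OF this, of 0] show ?case by simp
  next
    case (insert a A)
    have "(\<Sum>a\<in>A. scale (g a) a) \<in> V"
      using insert.prems by (intro subspace_sum[OF subV]) (auto intro: subspace_scale[OF subV])
    moreover have "scale (g a) a \<in> V" using insert.prems by (auto intro: subspace_scale[OF subV])
    ultimately show ?case using insert add scl by simp
  qed
  have rep: "(\<Sum>a\<in>A. scale (representation A v a) a) = v"
    if "independent A" "span A = V" "finite A" "v \<in> V" for A v
    using sum_representation_eq[of A v A] that by auto
  have 1: "representation S (T b) b = (\<Sum>a\<in>R. representation R b a * representation S (T a) b)"
    if "b \<in> S" for b
  proof -
    have "T b = T (\<Sum>a\<in>R. scale (representation R b a) a)"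
      using rep[OF R \<open>finite R\<close>, of b] that SV by auto
    also have "\<dots> = (\<Sum>a\<in>R. scale (representation R b a) (T a))"
      by (rule Tsum[OF \<open>finite R\<close> RV])
    finally have "representation S (T b) = representation S (\<Sum>a\<in>R. scale (representation R b a) (T a))"
      by simp
    also have "\<dots> = (\<lambda>c. \<Sum>a\<in>R. representation S (scale (representation R b a) (T a)) c)"
      using T RV by (subst representation_sum[OF S(1)]) (auto simp: S(2) intro!: subspace_scale[OF subV])
    also have "\<dots> = (\<lambda>c. \<Sum>a\<in>R. representation R b a * representation S (T a) c)"
      using T RV by (intro ext sum.cong refl) (auto simp: S(2) representation_scale[OF S(1)])
    finally show ?thesis by simp
  qed
  have 2: "representation R (T a) a = (\<Sum>b\<in>S. representation R b a * representation S (T a) b)"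
    if "a \<in> R" for a
  proof -
    have "T a = (\<Sum>b\<in>S. scale (representation S (T a) b) b)"
      using rep[OF S, of "T a"] that RV T by auto
    then have "representation R (T a) = representation R (\<Sum>b\<in>S. scale (representation S (T a) b) b)"
      by simp
    also have "\<dots> = (\<lambda>c. \<Sum>b\<in>S. representation R (scale (representation S (T a) b) b) c)"
      using SV by (subst representation_sum[OF R(1)]) (auto simp: R(2) intro!: subspace_scale[OF subV])
    also have "\<dots> = (\<lambda>c. \<Sum>b\<in>S. representation S (T a) b * representation R b c)"
      using SV by (intro ext sum.cong refl) (auto simp: R(2) representation_scale[OF R(1)])
    finally show ?thesis by (simp add: mult.commute)
  qed
  have "(\<Sum>b\<in>S. representation S (T b) b) = (\<Sum>a\<in>R. representation R (T a) a)"
    using 1 2 sum.swap[of "\<lambda>b a. representation R b a * representation S (T a) b" R S] by simp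
  then show ?thesis by (simp add: local.trace_on_def Let_def flip: R_def)
qed

end


section \<open>\<open>gl\<^sub>n\<close> and \<open>sl\<^sub>n\<close> over the complex numbers\<close>

definition mscale :: "complex \<Rightarrow> complex^'n^'n \<Rightarrow> complex^'n^'n" where
  "mscale c A = (\<chi> i j. c * A $ i $ j)"

global_interpretation gl: vector_space mscale
  by unfold_locales (simp_all add: mscale_def vec_eq_iff algebra_simps)

definition commutator :: "complex^'n^'n \<Rightarrow> complex^'n^'n \<Rightarrow> complex^'n^'n" where
  "commutator A B = A ** B - B ** A"

definition sl :: "(complex^'n^'n) set" where
  "sl = {A. trace A = 0}"

abbreviation killing_sl :: "complex^'n^'n \<Rightarrow> complex^'n^'n \<Rightarrow> complex" where
  "killing_sl \<equiv> gl.killing_form sl commutator"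

definition unit_mat :: "'n \<Rightarrow> 'n \<Rightarrow> complex^'n^'n" where
  "unit_mat i j = (\<chi> k l. if k = i \<and> l = j then 1 else 0)"

definition coord :: "'n \<Rightarrow> 'n \<Rightarrow> complex^'n^'n \<Rightarrow> complex" where
  "coord i j A = A $ i $ j"

abbreviation gl_dual :: "(complex^'n^'n \<Rightarrow> complex) set" where
  "gl_dual \<equiv> gl.dual_on UNIV"

abbreviation sl_dual :: "(complex^'n^'n \<Rightarrow> complex) set" where
  "sl_dual \<equiv> gl.dual_on sl"

text \<open>
  The linear map \<open>gl\<^sub>n\<^sup>* \<rightarrow> gl\<^sub>n\<close> with \<open>f\<^sub>i\<^sub>j \<mapsto> E\<^sub>j\<^sub>i\<close>, where \<open>f\<^sub>i\<^sub>j = coord i j\<close>; the coefficient of \<open>\<phi>\<close> at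
  \<open>f\<^sub>i\<^sub>j\<close> is \<open>\<phi> E\<^sub>i\<^sub>j\<close>. See \<open>gl_dual_to_gl_unique\<close>.
\<close>

definition gl_dual_to_gl :: "(complex^'n^'n \<Rightarrow> complex) \<Rightarrow> complex^'n^'n" where
  "gl_dual_to_gl \<phi> = (\<Sum>i\<in>UNIV. \<Sum>j\<in>UNIV. mscale (\<phi> (unit_mat i j)) (unit_mat j i))"

text \<open>
  The inclusion of \<open>sl\<^sub>n\<^sup>*\<close> into \<open>gl\<^sub>n\<^sup>*\<close>: \<open>A - (trace A / n) I\<close> is the component of \<open>A\<close> in \<open>sl\<^sub>n\<close> along
  \<open>gl\<^sub>n = sl\<^sub>n \<oplus> \<complex> I\<close>. See \<open>zero_extend_unique\<close>.
\<close>

definition zero_extend :: "(complex^'n^'n \<Rightarrow> complex) \<Rightarrow> complex^'n^'n \<Rightarrow> complex" where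
  "zero_extend \<phi> A = \<phi> (A - mscale (trace A / of_nat CARD('n)) (mat 1))"

definition B_map :: "(complex^'n^'n \<Rightarrow> complex) \<Rightarrow> complex^'n^'n" where
  "B_map \<phi> = gl_dual_to_gl (zero_extend \<phi>)"

definition B_form :: "complex^'n^'n \<Rightarrow> complex^'n^'n \<Rightarrow> complex" where
  "B_form x y = the_inv_into sl_dual B_map x y"


section \<open>The maps above are as intended\<close>

lemma mscale_nth [simp]: "mscale c A $ i $ j = c * A $ i $ j"
  by (simp add: mscale_def)

lemma unit_mat_nth [simp]: "unit_mat i j $ k $ l = (if k = i \<and> l = j then 1 else 0)"
  by (simp add: unit_mat_def)

lemma trace_mscale [simp]: "trace (mscale c A) = c * trace A"
  by (simp add: trace_def sum_distrib_left)

lemma coord_unit_mat: "coord i j (unit_mat k l) = (if i = k \<and> j = l then 1 else 0)"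
  by (auto simp: coord_def)

lemma subspace_sl: "gl.subspace sl"
  by (auto simp: gl.subspace_def sl_def trace_add) (simp add: trace_def)

lemma commutator_in_sl: "commutator A B \<in> sl"
  using trace_mul_sym[of A B] by (simp add: sl_def commutator_def trace_sub)

lemma gl_dual_iff:
  "\<phi> \<in> gl_dual \<longleftrightarrow>
     (\<forall>x y. \<phi> (x + y) = \<phi> x + \<phi> y) \<and> (\<forall>c x. \<phi> (mscale c x) = c * \<phi> x)"
  by (simp add: gl.dual_on_def)

lemma gl_dual_sum:
  assumes "\<phi> \<in> gl_dual" shows "\<phi> (\<Sum>i\<in>I. g i) = (\<Sum>i\<in>I. \<phi> (g i))"
proof -
  have "\<phi> 0 = 0" using assms gl.scale_zero_left[of 0] unfolding gl_dual_iff by (metis mult_zero_left)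
  then show ?thesis
    using assms by (induction I rule: infinite_finite_induct) (auto simp: gl_dual_iff)
qed

lemma mat_expand: "A = (\<Sum>i\<in>UNIV. \<Sum>j\<in>UNIV. mscale (A $ i $ j) (unit_mat i j))"
proof -
  have "(\<Sum>i\<in>UNIV. \<Sum>j\<in>UNIV. A $ i $ j * (if k = i \<and> l = j then 1 else 0)) = A $ k $ l" for k l
  proof -
    have "(\<Sum>i\<in>UNIV. \<Sum>j\<in>UNIV. A $ i $ j * (if k = i \<and> l = j then 1 else 0))
        = (\<Sum>i\<in>UNIV. \<Sum>j\<in>UNIV. if l = j then (if k = i then A $ i $ j else 0) else 0)"
      by (intro sum.cong refl) simp
    also have "\<dots> = A $ k $ l" by simp
    finally show ?thesis .
  qed
  then show ?thesis by (simp add: vec_eq_iff)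
qed

lemma gl_dual_expand:
  assumes "\<phi> \<in> gl_dual"
  shows "\<phi> A = (\<Sum>i\<in>UNIV. \<Sum>j\<in>UNIV. \<phi> (unit_mat i j) * coord i j A)"
proof -
  have "\<phi> A = \<phi> (\<Sum>i\<in>UNIV. \<Sum>j\<in>UNIV. mscale (A $ i $ j) (unit_mat i j))"
    by (simp flip: mat_expand)
  also have "\<dots> = (\<Sum>i\<in>UNIV. \<Sum>j\<in>UNIV. \<phi> (unit_mat i j) * coord i j A)"
    using assms by (simp add: gl_dual_sum gl_dual_iff coord_def mult.commute)
  finally show ?thesis .
qed

lemma coord_in_gl_dual: "coord i j \<in> gl_dual"
  by (simp add: gl_dual_iff coord_def)

lemma gl_dual_to_gl_nth: "gl_dual_to_gl \<phi> $ i $ j = \<phi> (unit_mat j i)"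
proof -
  have "gl_dual_to_gl \<phi> = (\<Sum>i\<in>UNIV. \<Sum>j\<in>UNIV. mscale (\<phi> (unit_mat j i)) (unit_mat i j))"
    unfolding gl_dual_to_gl_def by (rule sum.swap)
  also have "\<dots> = (\<chi> i j. \<phi> (unit_mat j i))"
    by (subst (2) mat_expand) simp
  finally show ?thesis by simp
qed

lemma gl_dual_to_gl_coord: "gl_dual_to_gl (coord i j) = unit_mat j i"
  by (auto simp: vec_eq_iff gl_dual_to_gl_nth coord_unit_mat)

lemma gl_dual_to_gl_add:
  "gl_dual_to_gl (\<lambda>A. \<phi> A + \<psi> A) = gl_dual_to_gl \<phi> + gl_dual_to_gl \<psi>"
  by (simp add: vec_eq_iff gl_dual_to_gl_nth)

lemma gl_dual_to_gl_scale: "gl_dual_to_gl (\<lambda>A. c * \<phi> A) = mscale c (gl_dual_to_gl \<phi>)"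
  by (simp add: vec_eq_iff gl_dual_to_gl_nth)

lemma gl_dual_to_gl_unique:
  fixes F :: "(complex^'n^'n \<Rightarrow> complex) \<Rightarrow> complex^'n^'n"
  assumes add: "\<And>\<phi> \<psi>. \<phi> \<in> gl_dual \<Longrightarrow> \<psi> \<in> gl_dual \<Longrightarrow> F (\<lambda>A. \<phi> A + \<psi> A) = F \<phi> + F \<psi>"
    and scl: "\<And>c \<phi>. \<phi> \<in> gl_dual \<Longrightarrow> F (\<lambda>A. c * \<phi> A) = mscale c (F \<phi>)"
    and basis: "\<And>i j. F (coord i j) = unit_mat j i"
    and "\<phi> \<in> gl_dual"
  shows "F \<phi> = gl_dual_to_gl \<phi>"
proof -
  have zero: "F (\<lambda>A. 0) = 0"
  proof -
    have "(\<lambda>A. 0) \<in> gl_dual" by (simp add: gl_dual_iff)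
    from scl[OF this, of 0] show ?thesis by simp
  qed
  have *: "F (\<lambda>A. \<Sum>i\<in>I. g i A) = (\<Sum>i\<in>I. F (g i))"
    if "\<And>i. g i \<in> gl_dual" "finite I" for I :: "'n set" and g
    using that(2)
  proof (induction I)
    case (insert i I)
    have "(\<lambda>A. \<Sum>i\<in>I. g i A) \<in> gl_dual"
      using that(1) by (simp add: gl_dual_iff sum.distrib sum_distrib_left)
    then show ?case using insert add[OF that(1)] by simp
  qed (simp add: zero)
  have mem: "(\<lambda>A. c * coord i j A) \<in> gl_dual" for c i j
    by (simp add: gl_dual_iff coord_def algebra_simps)
  have mem2: "(\<lambda>A. \<Sum>j\<in>UNIV. \<phi> (unit_mat i j) * coord i j A) \<in> gl_dual" for i
    by (simp add: gl_dual_iff coord_def algebra_simps sum.distrib sum_distrib_left)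
  have "\<phi> = (\<lambda>A. \<Sum>i\<in>UNIV. \<Sum>j\<in>UNIV. \<phi> (unit_mat i j) * coord i j A)"
    using gl_dual_expand[OF \<open>\<phi> \<in> gl_dual\<close>] by (rule ext)
  then have "F \<phi> = F (\<lambda>A. \<Sum>i\<in>UNIV. \<Sum>j\<in>UNIV. \<phi> (unit_mat i j) * coord i j A)"
    by (rule arg_cong)
  also have "\<dots> = gl_dual_to_gl \<phi>"
    unfolding gl_dual_to_gl_def
    by (simp add: *[OF mem2] *[OF mem] scl[OF coord_in_gl_dual] basis)
  finally show ?thesis .
qed

lemma trace_proj:
  "A - mscale (trace A / of_nat CARD('n)) (mat 1) \<in> sl" for A :: "complex^'n^'n"
  by (simp add: sl_def trace_sub trace_I)

lemma zero_extend_on_sl: "A \<in> sl \<Longrightarrow> zero_extend \<phi> A = \<phi> A"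
  by (simp add: zero_extend_def sl_def)

lemma zero_extend_in_gl_dual:
  fixes \<phi> :: "complex^'n^'n \<Rightarrow> complex"
  assumes "\<phi> \<in> sl_dual" shows "zero_extend \<phi> \<in> gl_dual"
proof -
  let ?p = "\<lambda>A::complex^'n^'n. A - mscale (trace A / of_nat CARD('n)) (mat 1)"
  have "?p (A + A') = ?p A + ?p A'" for A A'
    by (simp add: vec_eq_iff trace_add add_divide_distrib algebra_simps)
  moreover have "?p (mscale c A) = mscale c (?p A)" for c A
    by (simp add: vec_eq_iff algebra_simps)
  moreover have "\<phi> (A + A') = \<phi> A + \<phi> A'" if "A \<in> sl" "A' \<in> sl" for A A'
    using assms that by (simp add: gl.dual_on_def)
  moreover have "\<phi> (mscale c A) = c * \<phi> A" if "A \<in> sl" for c A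
    using assms that by (simp add: gl.dual_on_def)
  ultimately show ?thesis
    unfolding gl_dual_iff zero_extend_def by (simp only: trace_proj) simp
qed

lemma zero_extend_mat_1:
  assumes "\<phi> \<in> sl_dual" shows "zero_extend \<phi> (mat 1) = 0"
proof -
  have "\<phi> (mscale 0 0) = 0 * \<phi> 0"
    using assms gl.subspace_0[OF subspace_sl] unfolding gl.dual_on_def by blast
  then show ?thesis by (simp add: zero_extend_def trace_I)
qed

lemma zero_extend_unique:
  fixes \<psi> :: "complex^'n^'n \<Rightarrow> complex"
  assumes "\<psi> \<in> gl_dual" "\<And>A. A \<in> sl \<Longrightarrow> \<psi> A = \<phi> A" "\<psi> (mat 1) = 0"
  shows "\<psi> = zero_extend \<phi>"
proof
  fix A :: "complex^'n^'n"
  let ?c = "trace A / of_nat CARD('n)"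
  have "\<psi> A = \<psi> ((A - mscale ?c (mat 1)) + mscale ?c (mat 1))" by simp
  also have "\<dots> = \<psi> (A - mscale ?c (mat 1))"
    using assms(1,3) unfolding gl_dual_iff by (metis add.right_neutral mult_zero_right)
  finally show "\<psi> A = zero_extend \<phi> A"
    using assms(2)[OF trace_proj] by (simp add: zero_extend_def)
qed

lemma B_map_add:
  "B_map (\<lambda>A\<in>sl. \<phi> A + \<psi> A) = B_map \<phi> + B_map \<psi>" for \<phi> :: "complex^'n^'n \<Rightarrow> complex"
  by (simp add: vec_eq_iff B_map_def gl_dual_to_gl_nth zero_extend_def trace_proj)

lemma B_map_scale:
  "B_map (\<lambda>A\<in>sl. c * \<phi> A) = mscale c (B_map \<phi>)" for \<phi> :: "complex^'n^'n \<Rightarrow> complex"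
  by (simp add: vec_eq_iff B_map_def gl_dual_to_gl_nth zero_extend_def trace_proj)

lemma bij_betw_B_map: "bij_betw B_map sl_dual sl"
proof (rule bij_betw_imageI)
  show "inj_on B_map sl_dual"
  proof (rule inj_onI)
    fix \<phi> \<psi> :: "complex^'n^'n \<Rightarrow> complex"
    assume \<phi>: "\<phi> \<in> sl_dual" and \<psi>: "\<psi> \<in> sl_dual" and eq: "B_map \<phi> = B_map \<psi>"
    have "zero_extend \<phi> (unit_mat i j) = zero_extend \<psi> (unit_mat i j)" for i j
      using arg_cong[OF eq, of "\<lambda>M. M $ j $ i"] by (simp add: B_map_def gl_dual_to_gl_nth)
    then have "zero_extend \<phi> = zero_extend \<psi>"
      using gl_dual_expand zero_extend_in_gl_dual \<phi> \<psi> by (metis (no_types, lifting) ext sum.cong)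
    then have "\<phi> A = \<psi> A" if "A \<in> sl" for A
      using zero_extend_on_sl[OF that] by metis
    then show "\<phi> = \<psi>"
      using \<phi> \<psi> by (intro extensionalityI[of _ sl]) (auto simp: gl.dual_on_def)
  qed
next
  show "B_map ` sl_dual = sl"
  proof (intro equalityI subsetI)
    fix x :: "complex^'n^'n" assume "x \<in> B_map ` sl_dual"
    then obtain \<phi> where \<phi>: "\<phi> \<in> sl_dual" and x: "x = B_map \<phi>" by auto
    have "mat 1 = (\<Sum>i\<in>UNIV. unit_mat i i :: complex^'n^'n)"
      by (auto simp: vec_eq_iff mat_def if_distrib intro!: sum.neutral)
    then have "trace x = zero_extend \<phi> (mat 1)"
      using zero_extend_in_gl_dual[OF \<phi>]
      by (simp add: x trace_def B_map_def gl_dual_to_gl_nth gl_dual_sum)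
    then show "x \<in> sl" using zero_extend_mat_1[OF \<phi>] by (simp add: sl_def)
  next
    fix x :: "complex^'n^'n" assume x: "x \<in> sl"
    let ?t = "\<lambda>A. trace (x ** A)"
    have t: "?t \<in> gl_dual"
      unfolding gl_dual_iff
      by (simp add: trace_def matrix_matrix_mult_def algebra_simps sum.distrib sum_distrib_left)
    have "restrict ?t sl \<in> sl_dual"
      using t gl.subspace_add[OF subspace_sl] gl.subspace_scale[OF subspace_sl]
      by (auto simp: gl.dual_on_def)
    moreover have "?t = zero_extend (restrict ?t sl)"
      using t x by (intro zero_extend_unique) (auto simp: sl_def)
    moreover have "?t (unit_mat j i) = x $ i $ j" for i j
    proof -
      have "?t (unit_mat j i) = (\<Sum>k\<in>UNIV. \<Sum>l\<in>UNIV. if l = j then (if k = i then x $ k $ l else 0) else 0)"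
        unfolding trace_def matrix_matrix_mult_def vec_lambda_beta by (intro sum.cong refl) simp
      then show ?thesis by simp
    qed
    ultimately show "x \<in> B_map ` sl_dual"
      by (intro image_eqI[of _ _ "restrict ?t sl"])
        (auto simp: vec_eq_iff B_map_def gl_dual_to_gl_nth dest: fun_cong)
  qed
qed

end

theory Submission
  imports Defs
begin

text \<open>
  Both forms are multiples of the trace form \<open>tr (x y)\<close>.

  A functional \<open>\<phi>\<close> on \<open>gl\<^sub>n\<close> is sent to the matrix with entries \<open>\<phi> E\<^sub>j\<^sub>i\<close> at \<open>(i, j)\<close>, and this matrix is
  exactly the one that represents \<open>\<phi>\<close> through the trace form. For \<open>x\<close> of trace zero, \<open>tr (x \<cdot>)\<close>
  vanishes on the identity, so it is the extension of its own restriction to \<open>sl\<^sub>n\<close>; therefore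
  \<open>B\<close> inverts \<open>x \<mapsto> tr (x \<cdot>)\<close> and \<open>(x, y)\<^sub>B = tr (x y)\<close> (\<open>B_form_eq_trace\<close>).

  For the Killing form, the endomorphism \<open>ad x \<circ> ad y\<close> makes sense on all of \<open>gl\<^sub>n\<close> and has values in
  \<open>sl\<^sub>n\<close>, and an endomorphism has the same trace on any subspace that contains its image
  (\<open>trace_on_image_subset\<close>). On \<open>gl\<^sub>n\<close> the matrix units are a basis, and in this basis \<open>A \<mapsto> P A Q\<close> has trace
  \<open>tr P tr Q\<close> (\<open>sum_diagonal_sandwich\<close>). Expanding
  \<open>[x, [y, A]] = (x y) A - x A y - y A x + A (y x)\<close> into four such maps, the middle two contribute
  \<open>tr x tr y = 0\<close> each and the outer two \<open>n tr (x y)\<close> each. Hence the Killing form is \<open>2 n tr (x y)\<close>.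
\<close>

context vector_space
begin

text \<open>
  Extend a basis of \<open>U\<close> to one of \<open>V\<close>: the matrix of \<open>T\<close> then has zero rows at the added vectors, as
  \<open>T\<close> has values in \<open>U\<close>, so only the basis of \<open>U\<close> contributes to the diagonal sum.
\<close>

lemma trace_on_image_subset:
  assumes V: "finite W" "span W = V" and U: "subspace U" "U \<subseteq> V"
    and T: "\<And>x. x \<in> V \<Longrightarrow> T x \<in> U"
    and add: "\<And>x y. x \<in> V \<Longrightarrow> y \<in> V \<Longrightarrow> T (x + y) = T x + T y"
    and scl: "\<And>c x. x \<in> V \<Longrightarrow> T (scale c x) = scale c (T x)"
  shows "local.trace_on U T = local.trace_on V T"
proof -
  obtain S where S: "S \<subseteq> U" "independent S" "U \<subseteq> span S"
    using maximal_independent_subset by blast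
  have spanS: "span S = U"
    using S U(1) by (intro equalityI span_minimal) auto
  obtain R where R: "S \<subseteq> R" "R \<subseteq> V" "independent R" "V \<subseteq> span R"
    using maximal_independent_subset_extend[of S V] S U(2) by (metis order_trans)
  have spanR: "span R = V"
    using R V(2) subspace_span by (intro equalityI span_minimal) auto
  have finR: "finite R"
    using independent_span_bound[OF V(1) R(3)] R(2) V(2) by simp
  have finS: "finite S" using finR R(1) finite_subset by blast
  have rep: "representation R (T b) = representation S (T b)" if "b \<in> V" for b
    using representation_extend[OF R(3) _ R(1), of "T b"] T[OF that] spanS by simp
  have "local.trace_on V T = (\<Sum>b\<in>R. representation R (T b) b)"
    using R finR spanR T U add scl by (intro trace_on_eq) auto
  also have "\<dots> = (\<Sum>b\<in>R. representation S (T b) b)"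
    using rep R(2) by (intro sum.cong) auto
  also have "\<dots> = (\<Sum>b\<in>S. representation S (T b) b)"
    using representation_ne_zero finR R(1) by (intro sum.mono_neutral_right) auto
  also have "\<dots> = local.trace_on U T"
    by (intro trace_on_eq[symmetric]) (use S finS spanS T U add scl in \<open>simp_all add: subset_iff\<close>)
  finally show ?thesis by simp
qed

end

lemma inj_unit_mat: "inj (\<lambda>(i, j). unit_mat i j :: complex^'n^'n)"
proof (rule injI, clarify)
  fix i j k l :: 'n
  assume "(unit_mat i j :: complex^'n^'n) = unit_mat k l"
  from arg_cong[OF this, of "\<lambda>A. A $ i $ j"] show "i = k \<and> j = l"
    by (simp split: if_splits)
qed

abbreviation unit_mats :: "(complex^'n^'n) set" where
  "unit_mats \<equiv> range (\<lambda>(i, j). unit_mat i j)"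

lemma sum_unit_mats:
  "(\<Sum>b\<in>unit_mats. f b) = (\<Sum>i\<in>UNIV. \<Sum>j\<in>UNIV. f (unit_mat i j :: complex^'n^'n))"
proof -
  have "(\<Sum>b\<in>unit_mats. f b) = (\<Sum>(i, j)\<in>UNIV. f (unit_mat i j :: complex^'n^'n))"
    unfolding sum.reindex[OF inj_unit_mat] by (intro sum.cong) auto
  then show ?thesis by (simp add: sum.cartesian_product)
qed

lemma unit_mats_combination_nth:
  fixes g :: "complex^'n^'n \<Rightarrow> complex"
  shows "(\<Sum>b\<in>unit_mats. mscale (g b) b) $ i $ j = g (unit_mat i j)"
proof -
  have "(\<Sum>b\<in>unit_mats. mscale (g b) b)
      = (\<Sum>k\<in>UNIV. \<Sum>l\<in>UNIV. mscale (g (unit_mat k l)) (unit_mat k l))"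
    by (rule sum_unit_mats)
  also have "\<dots> = (\<chi> k l. g (unit_mat k l))"
    by (subst (2) mat_expand) simp
  finally show ?thesis by simp
qed

lemma independent_unit_mats: "gl.independent (unit_mats :: (complex^'n^'n) set)"
proof (rule gl.independent_if_scalars_zero)
  fix g :: "complex^'n^'n \<Rightarrow> complex" and b :: "complex^'n^'n"
  assume "(\<Sum>b\<in>unit_mats. mscale (g b) b) = 0" "b \<in> unit_mats"
  then show "g b = 0"
    using unit_mats_combination_nth[of g] by auto
qed simp

lemma span_unit_mats: "gl.span (unit_mats :: (complex^'n^'n) set) = UNIV"
proof (intro equalityI subsetI)
  fix A :: "complex^'n^'n"
  show "A \<in> gl.span unit_mats"
    by (subst mat_expand) (intro gl.span_sum gl.span_scale gl.span_base, auto)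
qed simp

lemma representation_unit_mats:
  "gl.representation unit_mats A (unit_mat i j) = A $ i $ j" for A :: "complex^'n^'n"
proof -
  have "(\<Sum>b\<in>unit_mats. mscale (gl.representation unit_mats A b) b) = A"
    by (rule gl.sum_representation_eq) (simp_all add: independent_unit_mats span_unit_mats)
  from unit_mats_combination_nth[of "gl.representation unit_mats A" i j, unfolded this]
  show ?thesis by (rule sym)
qed

lemma trace_on_gl:
  fixes T :: "complex^'n^'n \<Rightarrow> complex^'n^'n"
  assumes "\<And>A B. T (A + B) = T A + T B" "\<And>c A. T (mscale c A) = mscale c (T A)"
  shows "gl.trace_on UNIV T = (\<Sum>i\<in>UNIV. \<Sum>j\<in>UNIV. T (unit_mat i j) $ i $ j)"
proof -
  have "gl.trace_on UNIV T = (\<Sum>b\<in>unit_mats. gl.representation unit_mats (T b) b)"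
    using assms by (intro gl.trace_on_eq) (simp_all add: independent_unit_mats span_unit_mats)
  then show ?thesis
    by (simp only: sum_unit_mats representation_unit_mats)
qed

lemma mult_unit_mat_nth:
  "(P ** unit_mat i j) $ k $ m = (if m = j then P $ k $ i else 0)" for P :: "complex^'n^'n"
proof -
  have "(P ** unit_mat i j) $ k $ m
      = (\<Sum>r\<in>UNIV. if r = i then (if m = j then P $ k $ r else 0) else 0)"
    unfolding matrix_matrix_mult_def vec_lambda_beta by (intro sum.cong refl) simp
  then show ?thesis by simp
qed

lemma sandwich_unit_mat_nth:
  "(P ** unit_mat i j ** Q) $ k $ l = P $ k $ i * Q $ j $ l" for P Q :: "complex^'n^'n"
proof -
  have "(P ** unit_mat i j ** Q) $ k $ l = (\<Sum>m\<in>UNIV. (P ** unit_mat i j) $ k $ m * Q $ m $ l)"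
    by (simp add: matrix_matrix_mult_def)
  also have "\<dots> = (\<Sum>m\<in>UNIV. if m = j then P $ k $ i * Q $ m $ l else 0)"
    unfolding mult_unit_mat_nth by (intro sum.cong refl) simp
  finally show ?thesis by simp
qed

text \<open>
  This is the trace of \<open>P \<otimes> Q\<^sup>T\<close>, in the guise of the map \<open>A \<mapsto> P A Q\<close>.
\<close>

lemma sum_diagonal_sandwich:
  "(\<Sum>i\<in>UNIV. \<Sum>j\<in>UNIV. (P ** unit_mat i j ** Q) $ i $ j) = trace P * trace Q"
  for P Q :: "complex^'n^'n"
  by (simp add: sandwich_unit_mat_nth trace_def sum_product)

lemma matrix_add_rdistrib: "(A + B) ** C = A ** C + B ** C"
  by (simp add: vec_eq_iff matrix_matrix_mult_def distrib_right sum.distrib)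

lemma matrix_diff_ldistrib: "A ** (B - C) = A ** B - A ** C"
  for A :: "'a::ring_1^'n^'m"
  by (simp add: vec_eq_iff matrix_matrix_mult_def right_diff_distrib sum_subtractf)

lemma matrix_diff_rdistrib: "(A - B) ** C = A ** C - B ** C"
  for A :: "'a::ring_1^'n^'m"
  by (simp add: vec_eq_iff matrix_matrix_mult_def left_diff_distrib sum_subtractf)

lemma mscale_mult_left: "mscale c A ** B = mscale c (A ** B)"
  by (simp add: vec_eq_iff matrix_matrix_mult_def sum_distrib_left mult.assoc)

lemma mscale_mult_right: "A ** mscale c B = mscale c (A ** B)"
  by (simp add: vec_eq_iff matrix_matrix_mult_def sum_distrib_left algebra_simps)

lemma commutator_add_right: "commutator x (A + B) = commutator x A + commutator x B"
  by (simp add: commutator_def matrix_add_ldistrib matrix_add_rdistrib)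

lemma commutator_mscale_right: "commutator x (mscale c A) = mscale c (commutator x A)"
  by (simp add: commutator_def mscale_mult_left mscale_mult_right gl.scale_right_diff_distrib)

text \<open>
  The factors \<open>mat 1\<close> put all four terms in the form \<open>P ** A ** Q\<close> of \<open>sum_diagonal_sandwich\<close>.
\<close>

lemma commutator_commutator:
  "commutator x (commutator y A)
    = (x ** y) ** A ** mat 1 - x ** A ** y - y ** A ** x + mat 1 ** A ** (y ** x)"
  by (simp add: commutator_def matrix_diff_ldistrib matrix_diff_rdistrib matrix_mul_assoc)

lemma killing_sl_eq_trace:
  fixes x y :: "complex^'n^'n"
  assumes "x \<in> sl" "y \<in> sl"
  shows "killing_sl x y = 2 * of_nat CARD('n) * trace (x ** y)"
proof -
  let ?T = "commutator x \<circ> commutator y"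
  have add: "?T (A + B) = ?T A + ?T B" and scl: "?T (mscale c A) = mscale c (?T A)" for A B c
    by (simp_all add: commutator_add_right commutator_mscale_right)
  have "killing_sl x y = gl.trace_on UNIV ?T"
    unfolding gl.killing_form_def
    by (rule gl.trace_on_image_subset[OF _ span_unit_mats])
      (simp_all add: subspace_sl commutator_in_sl commutator_add_right commutator_mscale_right)
  also have "\<dots> = (\<Sum>i\<in>UNIV. \<Sum>j\<in>UNIV. ?T (unit_mat i j) $ i $ j)"
    by (rule trace_on_gl[OF add scl])
  also have "\<dots> = trace (x ** y) * trace (mat 1 :: complex^'n^'n) - trace x * trace y
      - trace y * trace x + trace (mat 1 :: complex^'n^'n) * trace (y ** x)"
    unfolding o_apply commutator_commutator vector_add_component vector_minus_component
      sum.distrib sum_subtractf sum_diagonal_sandwich by (rule refl)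
  also have "\<dots> = 2 * of_nat CARD('n) * trace (x ** y)"
    using assms trace_mul_sym[of x y] by (simp add: sl_def trace_I)
  finally show ?thesis .
qed

lemma trace_mult_in_gl_dual: "(\<lambda>A. trace (x ** A)) \<in> gl_dual"
  by (simp add: gl_dual_iff matrix_add_ldistrib trace_add mscale_mult_right)

lemma gl_dual_to_gl_trace_mult: "gl_dual_to_gl (\<lambda>A. trace (x ** A)) = x" for x :: "complex^'n^'n"
proof -
  have "trace (x ** unit_mat j i) = x $ i $ j" for i j
    by (simp add: trace_def mult_unit_mat_nth)
  then show ?thesis by (simp add: vec_eq_iff gl_dual_to_gl_nth)
qed

lemma B_form_eq_trace:
  fixes x y :: "complex^'n^'n"
  assumes x: "x \<in> sl" and y: "y \<in> sl"
  shows "B_form x y = trace (x ** y)"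
proof -
  let ?t = "\<lambda>A. trace (x ** A)"
  have dual: "restrict ?t sl \<in> sl_dual"
    using trace_mult_in_gl_dual[of x] gl.subspace_add[OF subspace_sl] gl.subspace_scale[OF subspace_sl]
    by (auto simp: gl.dual_on_def)
  have ext: "?t = zero_extend (restrict ?t sl)"
    using trace_mult_in_gl_dual[of x] x by (intro zero_extend_unique) (auto simp: sl_def)
  have "B_map (restrict ?t sl) = x"
    unfolding B_map_def ext[symmetric] by (rule gl_dual_to_gl_trace_mult)
  then have "the_inv_into sl_dual B_map x = restrict ?t sl"
    using bij_betw_imp_inj_on[OF bij_betw_B_map] dual by (intro the_inv_into_f_eq)
  then show ?thesis using y by (simp add: B_form_def)
qed

theorem theorem5p2:
  assumes "CARD('n::finite) \<ge> 2"
  shows "\<exists>c::complex. c \<noteq> 0 \<and>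
    (\<forall>x\<in>sl. \<forall>y\<in>sl. B_form x (y :: complex^'n^'n) = c * killing_sl x y)"
proof (intro exI conjI ballI)
  show "1 / (2 * of_nat CARD('n)) \<noteq> (0 :: complex)" by simp
  show "B_form x y = 1 / (2 * of_nat CARD('n)) * killing_sl x y"
    if "x \<in> sl" "y \<in> sl" for x y :: "complex^'n^'n"
    using that by (simp add: B_form_eq_trace killing_sl_eq_trace)
qed

end
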